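(* Let $n,N\ge 1$ be integers. For $0\le k\le N$ let $A_k,B_k$ be real $n\times n$ matrices such that $B_k$ and $I+A_k$ are invertible, and let $Q_k$ be real symmetric $n\times n$ matrices. Consider the linear space of pairs $(x,u)$ with $x=(x_0,\dots,x_{N+1})$, $u=(u_0,\dots,u_N)$, $x_k,u_k\in\mathbb{R}^n$, satisfying $$x_{k+1}-x_k=A_kx_k+B_ku_k,\quad 0\le k\le N,\qquad x_0=x_{N+1}=0,$$ and on this space the quadratic form $$\mathcal{J}(u)=\frac12\sum_{i=0}^N\left(|u_i|^2-\langle Q_ix_i,x_i\rangle\right).$$ Let $\det(\mathcal{J})$ be the determinant of the symmetric $nN\times nN$ matrix representing this quadratic form in the state coordinates $(x_1,\dots,x_N)\in\mathbb{R}^{nN}$. Then $$\det(\mathcal{J})=2^{-nN}\det(\Phi_3)\,\det(P_0^{N+1})\prod_{k=0}^N\det\Gamma_k^{-1},$$ where $\Phi_3$, $P_0^{N+1}$ and $\Gamma_k$ are the $n\times n$ matrices built from $A_k,B_k,Q_k$ as defined in the context.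
   Context: $I$ is the $n\times n$ identity matrix and ${}^t$ denotes transpose. Since the $B_k$ are invertible, on the constraint space one has $u_k=B_k^{-1}(x_{k+1}-(I+A_k)x_k)$, so the constraint space is parametrized by $(x_1,\dots,x_N)\in\mathbb{R}^{nN}$ and $\mathcal{J}$ becomes a quadratic form $\mathcal{J}(x)=\langle \mathsf{J}x,x\rangle$ with $\mathsf{J}$ a symmetric $nN\times nN$ matrix; $\det(\mathcal{J})$ means $\det \mathsf{J}$. (Thus $2\mathsf{J}$ is the block tridiagonal symmetric matrix with diagonal blocks $S_k=\Gamma_{k-1}^{-1}+(I+A_k)^t\Gamma_k^{-1}(I+A_k)-Q_k$, $1\le k\le N$, and blocks $R_k=-(I+A_k)^t\Gamma_k^{-1}$ in position $(k,k+1)$, $1\le k\le N-1$.) For $0\le k\le N$ set $\Gamma_k=B_kB_k^t$, $P_k^{k+1}=I+A_k$, $P_{k+1}^k=(I+A_k)^{-1}$, and let $P_0^{N+1}=(I+A_N)(I+A_{N-1})\cdots(I+A_0)$. Define the $2n\times2n$ matrices $$M_k=\begin{pmatrix}(P_{k+1}^k)^t&0\\ \Gamma_k(P_{k+1}^k)^t&P_k^{k+1}\end{pmatrix}\begin{pmatrix}I&-Q_k\\0&I\end{pmatrix},\qquad 0\le k\le N.$$ $\Phi_3$ is the lower-left $n\times n$ block of the ordered product $\Phi_{N+1}=M_NM_{N-1}\cdots M_0$. *)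

theory Defs
  imports "Jordan_Normal_Form.Determinant" "Jordan_Normal_Form.Gauss_Jordan_Elimination"
begin

text \<open>
  The matrices \<open>A k\<close>, \<open>B k\<close>, \<open>Q k\<close> are only meaningful for \<open>k \<le> N\<close>, the states \<open>x k\<close> for
  \<open>k \<le> N + 1\<close> and the controls \<open>u k\<close> for \<open>k \<le> N\<close>; values at other indices are never used.
\<close>

text \<open>Only meaningful for invertible matrices; for the others \<open>mat_inverse\<close> is \<open>None\<close>.\<close>

definition mat_inv :: "real mat \<Rightarrow> real mat" where
  "mat_inv M = the (mat_inverse M)"

definition constraint_space ::
  "nat \<Rightarrow> nat \<Rightarrow> (nat \<Rightarrow> real mat) \<Rightarrow> (nat \<Rightarrow> real mat) \<Rightarrow> ((nat \<Rightarrow> real vec) \<times> (nat \<Rightarrow> real vec)) set"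
where
  "constraint_space n N A B = {(x, u).
     (\<forall>k\<le>N+1. x k \<in> carrier_vec n) \<and> (\<forall>k\<le>N. u k \<in> carrier_vec n) \<and>
     (\<forall>k\<le>N. x (k+1) - x k = A k *\<^sub>v x k + B k *\<^sub>v u k) \<and>
     x 0 = 0\<^sub>v n \<and> x (N+1) = 0\<^sub>v n}"

definition cost ::
  "nat \<Rightarrow> (nat \<Rightarrow> real mat) \<Rightarrow> (nat \<Rightarrow> real vec) \<Rightarrow> (nat \<Rightarrow> real vec) \<Rightarrow> real"
where
  "cost N Q x u = (1/2) * (\<Sum>i=0..N. u i \<bullet> u i - (Q i *\<^sub>v x i) \<bullet> x i)"

text \<open>The vector \<open>(x\<^sub>1, \<dots>, x\<^sub>N)\<close> of length \<open>n * N\<close>, blocks of length \<open>n\<close> one after the other.\<close>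

definition state_coords :: "nat \<Rightarrow> nat \<Rightarrow> (nat \<Rightarrow> real vec) \<Rightarrow> real vec" where
  "state_coords n N x = vec (n * N) (\<lambda>i. x (i div n + 1) $ (i mod n))"

definition represents_cost ::
  "nat \<Rightarrow> nat \<Rightarrow> (nat \<Rightarrow> real mat) \<Rightarrow> (nat \<Rightarrow> real mat) \<Rightarrow> (nat \<Rightarrow> real mat) \<Rightarrow> real mat \<Rightarrow> bool"
where
  "represents_cost n N A B Q J \<longleftrightarrow>
     J \<in> carrier_mat (n * N) (n * N) \<and> transpose_mat J = J \<and>
     (\<forall>(x, u) \<in> constraint_space n N A B.
        cost N Q x u = (J *\<^sub>v state_coords n N x) \<bullet> state_coords n N x)"

text \<open>
  If all \<open>B k\<close> are invertible, every vector of length \<open>n * N\<close> is \<open>state_coords n N x\<close> for some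
  \<open>(x, u)\<close> in the constraint space, with the values of \<open>x\<close> and \<open>u\<close> at the meaningful indices
  uniquely determined; so exactly one symmetric matrix represents the cost.
\<close>

definition cost_matrix ::
  "nat \<Rightarrow> nat \<Rightarrow> (nat \<Rightarrow> real mat) \<Rightarrow> (nat \<Rightarrow> real mat) \<Rightarrow> (nat \<Rightarrow> real mat) \<Rightarrow> real mat"
where
  "cost_matrix n N A B Q = (THE J. represents_cost n N A B Q J)"

definition Gamma :: "(nat \<Rightarrow> real mat) \<Rightarrow> nat \<Rightarrow> real mat" where
  "Gamma B k = B k * transpose_mat (B k)"

text \<open>\<open>P_fwd\<close> is \<open>P\<^sub>k\<^sup>k\<^sup>+\<^sup>1\<close> and \<open>P_bwd\<close> is \<open>P\<^sub>k\<^sub>+\<^sub>1\<^sup>k\<close>.\<close>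

definition P_fwd :: "nat \<Rightarrow> (nat \<Rightarrow> real mat) \<Rightarrow> nat \<Rightarrow> real mat" where
  "P_fwd n A k = 1\<^sub>m n + A k"

definition P_bwd :: "nat \<Rightarrow> (nat \<Rightarrow> real mat) \<Rightarrow> nat \<Rightarrow> real mat" where
  "P_bwd n A k = mat_inv (1\<^sub>m n + A k)"

text \<open>\<open>ordered_prod m F K = F (K-1) * \<dots> * F 1 * F 0\<close>, for \<open>m \<times> m\<close> matrices.\<close>

fun ordered_prod :: "nat \<Rightarrow> (nat \<Rightarrow> real mat) \<Rightarrow> nat \<Rightarrow> real mat" where
  "ordered_prod m F 0 = 1\<^sub>m m"
| "ordered_prod m F (Suc k) = F k * ordered_prod m F k"

definition P_total :: "nat \<Rightarrow> nat \<Rightarrow> (nat \<Rightarrow> real mat) \<Rightarrow> real mat" where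
  "P_total n N A = ordered_prod n (P_fwd n A) (N+1)"

definition M_step ::
  "nat \<Rightarrow> (nat \<Rightarrow> real mat) \<Rightarrow> (nat \<Rightarrow> real mat) \<Rightarrow> (nat \<Rightarrow> real mat) \<Rightarrow> nat \<Rightarrow> real mat"
where
  "M_step n A B Q k =
     four_block_mat (transpose_mat (P_bwd n A k)) (0\<^sub>m n n)
                    (Gamma B k * transpose_mat (P_bwd n A k)) (P_fwd n A k)
     * four_block_mat (1\<^sub>m n) (- Q k) (0\<^sub>m n n) (1\<^sub>m n)"

definition Phi ::
  "nat \<Rightarrow> nat \<Rightarrow> (nat \<Rightarrow> real mat) \<Rightarrow> (nat \<Rightarrow> real mat) \<Rightarrow> (nat \<Rightarrow> real mat) \<Rightarrow> real mat"
where
  "Phi n N A B Q = ordered_prod (2 * n) (M_step n A B Q) (N+1)"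

definition Phi3 ::
  "nat \<Rightarrow> nat \<Rightarrow> (nat \<Rightarrow> real mat) \<Rightarrow> (nat \<Rightarrow> real mat) \<Rightarrow> (nat \<Rightarrow> real mat) \<Rightarrow> real mat"
where
  "Phi3 n N A B Q = (case split_block (Phi n N A B Q) n n of (_, _, C, _) \<Rightarrow> C)"

end

theory Submission
  imports Defs
begin

text \<open>
  The proof is a discrete Gelfand-Yaglom argument. Substituting
  \<open>u\<^sub>k = B\<^sub>k\<^sup>-\<^sup>1 (x\<^sub>k\<^sub>+\<^sub>1 - P\<^sub>k x\<^sub>k)\<close>, where \<open>P\<^sub>k = I + A\<^sub>k\<close>, in the cost and summing by parts shows that the
  matrix of the cost is half of a block tridiagonal matrix, the Hessian (\<open>cost_eq_hess\<close>); as every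
  sequence of intermediate states is admissible, no other symmetric matrix represents the cost
  (\<open>cost_matrix_eq_hess\<close>). The factor \<open>1/2\<close> contributes \<open>2\<^sup>-\<^sup>n\<^sup>N\<close>.

  The Hessian is the second order difference operator whose kernel equation is the Hamiltonian
  system generated by the \<open>M\<^sub>k\<close>, with the costate eliminated. So the states \<open>X\<^sub>k\<close> of the matrix
  solution with \<open>X\<^sub>0 = 0\<close> and costate \<open>Y\<^sub>0 = I\<close>, which are the lower left blocks of
  \<open>M\<^sub>k\<^sub>-\<^sub>1 \<cdots> M\<^sub>0\<close>, satisfy its three-term recurrence (\<open>flow_recurrence\<close>), and \<open>X\<^sub>N\<^sub>+\<^sub>1 = \<Phi>\<^sub>3\<close>.

  For a block tridiagonal matrix \<open>T\<close> with superdiagonal blocks \<open>U\<^sub>k\<close> and such a solution, one has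
  \<open>det T \<cdot> det X\<^sub>1 = (-1)\<^sup>n\<^sup>N det U\<^sub>1 \<cdots> det U\<^sub>N \<cdot> det X\<^sub>N\<^sub>+\<^sub>1\<close> (\<open>det_block_tridiag\<close>). For the Hessian,
  \<open>det U\<^sub>k = (-1)\<^sup>n det P\<^sub>k / det \<Gamma>\<^sub>k\<close> and \<open>det X\<^sub>1 = det \<Gamma>\<^sub>0 / det P\<^sub>0\<close>, and the formula follows.
\<close>

section \<open>Block tridiagonal matrices\<close>

text \<open>
  Block indices run over \<open>1, \<dots>, N\<close>, like the states \<open>x\<^sub>1, \<dots>, x\<^sub>N\<close> that they multiply: row \<open>k\<close>
  carries \<open>L k\<close>, \<open>D k\<close>, \<open>U k\<close> in columns \<open>k - 1\<close>, \<open>k\<close>, \<open>k + 1\<close>. The blocks \<open>L 1\<close> and \<open>U N\<close> fall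
  outside the matrix; they multiply the end states \<open>x\<^sub>0\<close> and \<open>x\<^sub>N\<^sub>+\<^sub>1\<close> in the three-term recurrence.
\<close>

definition tridiag_block ::
  "nat \<Rightarrow> (nat \<Rightarrow> real mat) \<Rightarrow> (nat \<Rightarrow> real mat) \<Rightarrow> (nat \<Rightarrow> real mat) \<Rightarrow> nat \<Rightarrow> nat \<Rightarrow> real mat"
where
  "tridiag_block n L D U a b =
     (if b = a then D a else if b = Suc a then U a else if a = Suc b then L a else 0\<^sub>m n n)"

definition block_tridiag ::
  "nat \<Rightarrow> nat \<Rightarrow> (nat \<Rightarrow> real mat) \<Rightarrow> (nat \<Rightarrow> real mat) \<Rightarrow> (nat \<Rightarrow> real mat) \<Rightarrow> real mat"
where
  "block_tridiag n N L D U = mat (n * N) (n * N)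
     (\<lambda>(i, j). tridiag_block n L D U (i div n + 1) (j div n + 1) $$ (i mod n, j mod n))"

lemma block_tridiag_carrier [simp]:
  "block_tridiag n N L D U \<in> carrier_mat (n * N) (n * N)"
  by (simp add: block_tridiag_def)

lemma div_block_less: "i < n * N \<Longrightarrow> i div n < N" for n :: nat
  by (simp add: less_mult_imp_div_less mult.commute)

lemma sum_by_blocks:
  fixes f :: "nat \<Rightarrow> 'a::comm_monoid_add"
  shows "(\<Sum>i<n * N. f i) = (\<Sum>b<N. \<Sum>q<n. f (b * n + q))"
proof -
  have "(\<Sum>i<n * N. f i) = (\<Sum>b<N. sum f {b * n..<b * n + n})"
    by (simp add: sum.nat_group mult.commute)
  also have "\<dots> = (\<Sum>b<N. \<Sum>q<n. f (b * n + q))"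
  proof (rule sum.cong[OF refl])
    fix b
    show "sum f {b * n..<b * n + n} = (\<Sum>q<n. f (b * n + q))"
      by (rule sum.reindex_bij_witness[where i = "\<lambda>q. b * n + q" and j = "\<lambda>i. i - b * n"]) auto
  qed
  finally show ?thesis .
qed

text \<open>
  A block tridiagonal matrix acts on a sequence of states as a three-term difference operator with
  Dirichlet conditions at both ends: those conditions make the terms with \<open>L 1\<close> and \<open>U N\<close>, absent
  from the matrix, vanish.
\<close>

lemma block_tridiag_mult_coords:
  assumes L: "\<And>k. 1 \<le> k \<Longrightarrow> k \<le> N \<Longrightarrow> L k \<in> carrier_mat n n"
    and D: "\<And>k. 1 \<le> k \<Longrightarrow> k \<le> N \<Longrightarrow> D k \<in> carrier_mat n n"
    and U: "\<And>k. 1 \<le> k \<Longrightarrow> k \<le> N \<Longrightarrow> U k \<in> carrier_mat n n"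
    and x: "\<And>k. k \<le> N + 1 \<Longrightarrow> x k \<in> carrier_vec n"
    and x0: "x 0 = 0\<^sub>v n" and xN: "x (N + 1) = 0\<^sub>v n"
  shows "block_tridiag n N L D U *\<^sub>v state_coords n N x =
    state_coords n N (\<lambda>k. L k *\<^sub>v x (k - 1) + D k *\<^sub>v x k + U k *\<^sub>v x (k + 1))"
    (is "?T *\<^sub>v ?x = state_coords n N ?y")
proof (rule eq_vecI)
  fix i assume "i < dim_vec (state_coords n N ?y)"
  then have i: "i < n * N" by (simp add: state_coords_def)
  then have n: "n > 0" by (cases n) auto
  define a where "a = i div n + 1"
  define p where "p = i mod n"
  have p: "p < n" using n by (simp add: p_def)
  have a: "1 \<le> a" "a \<le> N" using div_block_less[OF i] by (auto simp: a_def)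
  let ?E = "\<lambda>k. tridiag_block n L D U a k"
  have E: "?E k \<in> carrier_mat n n" for k
    using a L D U by (auto simp: tridiag_block_def)
  have E_mult: "(?E k *\<^sub>v x k) $ p = (\<Sum>q<n. ?E k $$ (p, q) * x k $ q)" if "k \<le> N + 1" for k
    using E[of k] x[OF that] p by (auto simp: scalar_prod_def lessThan_atLeast0)
  have "(?T *\<^sub>v ?x) $ i = (\<Sum>j<n * N. ?E (j div n + 1) $$ (p, j mod n) * x (j div n + 1) $ (j mod n))"
    using i by (simp add: block_tridiag_def state_coords_def scalar_prod_def lessThan_atLeast0 a_def p_def)
  also have "\<dots> = (\<Sum>b<N. \<Sum>q<n. ?E (b + 1) $$ (p, q) * x (b + 1) $ q)"
    unfolding sum_by_blocks using n by (intro sum.cong) auto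
  also have "\<dots> = (\<Sum>b<N. (?E (b + 1) *\<^sub>v x (b + 1)) $ p)"
    by (intro sum.cong refl) (simp add: E_mult)
  also have "\<dots> = (\<Sum>k\<in>{1..N}. (?E k *\<^sub>v x k) $ p)"
    by (rule sum.reindex_bij_witness[where i = "\<lambda>k. k - 1" and j = "\<lambda>b. b + 1"]) auto
  (* adding the end states, which are 0, brings all three neighbours a - 1, a, a + 1 into the range *)
  also have "\<dots> = (\<Sum>k\<in>{0..N + 1}. (?E k *\<^sub>v x k) $ p)"
  proof (rule sum.mono_neutral_left)
    have "(?E k *\<^sub>v x k) $ p = 0" if "k = 0 \<or> k = N + 1" for k
      using that x0 xN E[of k] p by auto
    then show "\<forall>k\<in>{0..N + 1} - {1..N}. (?E k *\<^sub>v x k) $ p = 0"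
      by (metis DiffE One_nat_def Suc_eq_plus1 atLeastAtMost_iff le_Suc_eq not_less_eq_eq le_zero_eq)
  qed auto
  also have "\<dots> = (\<Sum>k\<in>{0..N + 1}. (if k = a - 1 then (L a *\<^sub>v x (a - 1)) $ p else 0)
      + (if k = a then (D a *\<^sub>v x a) $ p else 0) + (if k = a + 1 then (U a *\<^sub>v x (a + 1)) $ p else 0))"
  proof (rule sum.cong[OF refl])
    fix k assume "k \<in> {0..N + 1}"
    then have xk: "x k \<in> carrier_vec n" using x by auto
    consider "k = a - 1" | "k = a" | "k = a + 1" | "k \<noteq> a - 1" "k \<noteq> a" "k \<noteq> a + 1" by blast
    then show "(?E k *\<^sub>v x k) $ p = (if k = a - 1 then (L a *\<^sub>v x (a - 1)) $ p else 0)
      + (if k = a then (D a *\<^sub>v x a) $ p else 0) + (if k = a + 1 then (U a *\<^sub>v x (a + 1)) $ p else 0)"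
      using a p xk by cases (auto simp: tridiag_block_def)
  qed
  also have "\<dots> = (L a *\<^sub>v x (a - 1)) $ p + (D a *\<^sub>v x a) $ p + (U a *\<^sub>v x (a + 1)) $ p"
    using a by (auto simp: sum.distrib)
  also have "\<dots> = state_coords n N ?y $ i"
    using i p L[OF a] D[OF a] U[OF a] by (simp add: state_coords_def a_def p_def)
  finally show "(?T *\<^sub>v ?x) $ i = state_coords n N ?y $ i" .
qed (simp add: block_tridiag_def state_coords_def)

text \<open>
  Dropping the first block column of a block tridiagonal matrix moves the blocks \<open>U k\<close> to the
  diagonal and leaves nothing above them. The leading \<open>m\<close> block rows are taken, to allow induction.
\<close>

lemma det_superdiagonal_part:
  assumes n: "n > 0"
    and L: "\<And>k. 1 \<le> k \<Longrightarrow> k \<le> N \<Longrightarrow> L k \<in> carrier_mat n n"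
    and D: "\<And>k. 1 \<le> k \<Longrightarrow> k \<le> N \<Longrightarrow> D k \<in> carrier_mat n n"
    and U: "\<And>k. 1 \<le> k \<Longrightarrow> k \<le> N \<Longrightarrow> U k \<in> carrier_mat n n"
  shows "m \<le> N \<Longrightarrow> det (mat (n * m) (n * m)
      (\<lambda>(i, j). tridiag_block n L D U (i div n + 1) (j div n + 2) $$ (i mod n, j mod n)))
    = (\<Prod>k=1..m. det (U k))"
proof (induction m)
  case 0
  show ?case by simp
next
  case (Suc m)
  let ?f = "\<lambda>(i, j). tridiag_block n L D U (i div n + 1) (j div n + 2) $$ (i mod n, j mod n)"
  let ?G = "\<lambda>m. mat (n * m) (n * m) ?f"
  let ?low = "mat n (n * m) (\<lambda>(i, j). ?f (i + n * m, j))"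
  have div_last: "i div n = m" if "\<not> i < n * m" "i < n * Suc m" for i
    using that n by (intro div_nat_eqI) auto
  have mod_last: "i mod n = i - n * m" if "\<not> i < n * m" "i < n * Suc m" for i
    using div_last[OF that] by (simp add: minus_mult_div_eq_mod[symmetric])
  have UC: "U (Suc m) \<in> carrier_mat n n" using U Suc.prems by auto
  have "?G (Suc m) = four_block_mat (?G m) (0\<^sub>m (n * m) n) ?low (U (Suc m))"
  proof (rule eq_matI)
    fix i j assume "i < dim_row (four_block_mat (?G m) (0\<^sub>m (n * m) n) ?low (U (Suc m)))"
      "j < dim_col (four_block_mat (?G m) (0\<^sub>m (n * m) n) ?low (U (Suc m)))"
    then have i: "i < n * Suc m" and j: "j < n * Suc m" using UC by auto
    show "?G (Suc m) $$ (i, j) = four_block_mat (?G m) (0\<^sub>m (n * m) n) ?low (U (Suc m)) $$ (i, j)"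
    proof (cases "i < n * m"; cases "j < n * m")
      assume a: "i < n * m" "\<not> j < n * m"
      have "i mod n < n" using n by simp
      then show ?thesis using i j a UC div_block_less[OF a(1)] div_last[OF a(2) j] mod_last[OF a(2) j]
        by (auto simp: tridiag_block_def)
    next
      assume a: "\<not> i < n * m" "\<not> j < n * m"
      show ?thesis using i j a UC div_last[OF a(2) j] mod_last[OF a(2) j] div_last[OF a(1) i] mod_last[OF a(1) i]
        by (auto simp: tridiag_block_def)
    next
      assume a: "\<not> i < n * m" "j < n * m"
      then show ?thesis using i j UC div_last[OF a(1) i] mod_last[OF a(1) i] by auto
    qed (use i j UC in auto)
  qed (use UC in auto)
  then have "det (?G (Suc m)) = det (?G m) * det (U (Suc m))"
    using det_four_block_mat_upper_right_zero[of "?G m" "n * m" "0\<^sub>m (n * m) n" n ?low "U (Suc m)"] UC by simp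
  then show ?case using Suc by simp
qed

text \<open>
  Discrete counterpart of the Gelfand-Yaglom formula: the determinant of a second order difference
  operator is governed by the end value of a solution of its initial value problem. Replacing the
  first block column of the identity by \<open>(X\<^sub>1, \<dots>, X\<^sub>N)\<close> gives a matrix \<open>V\<close> with determinant
  \<open>det X\<^sub>1\<close>. By the recurrence, the first block column of \<open>T V\<close> vanishes except for its last block
  \<open>- U\<^sub>N X\<^sub>N\<^sub>+\<^sub>1\<close>, the term that the truncated matrix misses; the other columns are those of \<open>T\<close>.
  Moving that column to the end leaves a block lower triangular matrix with diagonal
  \<open>U\<^sub>1, \<dots>, U\<^sub>N\<^sub>-\<^sub>1, - U\<^sub>N X\<^sub>N\<^sub>+\<^sub>1\<close>. Since no \<open>X\<^sub>k\<close> is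
  inverted, conjugate points, where some \<open>X\<^sub>k\<close> is singular, are covered.
\<close>

lemma det_block_tridiag:
  assumes n: "n > 0" and N: "N > 0"
    and L: "\<And>k. 1 \<le> k \<Longrightarrow> k \<le> N \<Longrightarrow> L k \<in> carrier_mat n n"
    and D: "\<And>k. 1 \<le> k \<Longrightarrow> k \<le> N \<Longrightarrow> D k \<in> carrier_mat n n"
    and U: "\<And>k. 1 \<le> k \<Longrightarrow> k \<le> N \<Longrightarrow> U k \<in> carrier_mat n n"
    and X: "\<And>k. k \<le> N + 1 \<Longrightarrow> X k \<in> carrier_mat n n"
    and X0: "X 0 = 0\<^sub>m n n"
    and rec: "\<And>k. 1 \<le> k \<Longrightarrow> k \<le> N \<Longrightarrow> L k * X (k - 1) + D k * X k + U k * X (k + 1) = 0\<^sub>m n n"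
  shows "det (block_tridiag n N L D U) * det (X 1) =
    (- 1) ^ (n * N) * (\<Prod>k=1..N. det (U k)) * det (X (N + 1))"
proof -
  obtain m where Nm: "N = Suc m" using N by (cases N) auto
  let ?T = "block_tridiag n N L D U"
  let ?W = "- (U N * X (N + 1))"
  have UN: "U N \<in> carrier_mat n n" using U N by auto
  have XN: "X (N + 1) \<in> carrier_mat n n" using X by auto
  have W: "?W \<in> carrier_mat n n" using UN XN by auto
  let ?c = "\<lambda>q. state_coords n N (\<lambda>k. col (X k) q)"
  have T_col: "(?T *\<^sub>v ?c q) $ i = (if i < n * m then 0 else ?W $$ (i - n * m, q))"
    if i: "i < n * N" and q: "q < n" for i q
  proof -
    (* the coordinates do not see the end value, which is replaced by the Dirichlet value 0 *)
    define x where "x k = (if k = N + 1 then 0\<^sub>v n else col (X k) q)" for k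
    define y where "y k = L k *\<^sub>v x (k - 1) + D k *\<^sub>v x k + U k *\<^sub>v x (k + 1)" for k
    have "?c q = state_coords n N x"
      by (intro eq_vecI) (auto simp: state_coords_def x_def dest: div_block_less)
    also have "?T *\<^sub>v \<dots> = state_coords n N y"
      unfolding y_def using L D U X q by (intro block_tridiag_mult_coords) (auto simp: x_def X0)
    finally have Tc: "?T *\<^sub>v ?c q = state_coords n N y" .
    define a where "a = i div n + 1"
    have a: "1 \<le> a" "a \<le> N" using div_block_less[OF i] by (auto simp: a_def)
    note LDU = L[OF a] D[OF a] U[OF a]
    have Xa: "X (a - 1) \<in> carrier_mat n n" "X a \<in> carrier_mat n n" "X (a + 1) \<in> carrier_mat n n"
      using X a by auto
    have p: "i mod n < n" using n by simp
    have "(L a * X (a - 1) + D a * X a + U a * X (a + 1)) $$ (i mod n, q) = 0"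
      using rec[OF a] p q by simp
    then have s: "row (L a) (i mod n) \<bullet> col (X (a - 1)) q + row (D a) (i mod n) \<bullet> col (X a) q
        + row (U a) (i mod n) \<bullet> col (X (a + 1)) q = 0"
      using LDU Xa p q by simp
    have y_eq: "y a $ (i mod n) = row (L a) (i mod n) \<bullet> x (a - 1) + row (D a) (i mod n) \<bullet> x a
        + row (U a) (i mod n) \<bullet> x (a + 1)"
      using LDU p by (simp add: y_def)
    show ?thesis
    proof (cases "i < n * m")
      case True
      then have "a < N" using div_block_less[OF True] by (simp add: a_def Nm)
      then have "y a $ (i mod n) = 0" using s y_eq a by (simp add: x_def)
      then show ?thesis unfolding Tc using i True by (simp add: state_coords_def a_def)
    next
      case False
      have d: "i div n = m" using False i n Nm by (intro div_nat_eqI) auto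
      then have aN: "a = N" by (simp add: a_def Nm)
      have "N - 1 \<noteq> N + 1" by simp
      have md: "i mod n = i - n * m" using d by (simp add: minus_mult_div_eq_mod[symmetric])
      have "row (U a) (i mod n) \<bullet> x (a + 1) = 0"
        using p LDU by (simp add: aN x_def)
      then have "y a $ (i mod n) = - (row (U N) (i mod n) \<bullet> col (X (N + 1)) q)"
        using s y_eq \<open>N - 1 \<noteq> N + 1\<close> by (simp add: x_def aN)
      also have "\<dots> = ?W $$ (i mod n, q)" using UN XN p q by simp
      finally show ?thesis unfolding Tc using i False by (simp add: state_coords_def a_def md)
    qed
  qed
  define V where "V = mat (n * N) (n * N) (\<lambda>(i, j). if j < n then ?c j $ i else if i = j then 1 else 0)"
  have V: "V \<in> carrier_mat (n * N) (n * N)" by (simp add: V_def)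
  have TV: "(?T * V) $$ (i, j) = (if j < n then if i < n * m then 0 else ?W $$ (i - n * m, j) else ?T $$ (i, j))"
    if i: "i < n * N" and j: "j < n * N" for i j
  proof (cases "j < n")
    case True
    have "col V j = ?c j" using True j by (auto simp: V_def state_coords_def)
    then have "(?T * V) $$ (i, j) = (?T *\<^sub>v ?c j) $ i" using i j V by (simp add: block_tridiag_def)
    then show ?thesis using T_col[OF i True] True by simp
  next
    case False
    have "col V j = unit_vec (n * N) j" using False j by (auto simp: V_def unit_vec_def)
    then have "(?T * V) $$ (i, j) = row ?T i \<bullet> unit_vec (n * N) j" 
      using i j V by (simp add: block_tridiag_def)
    also have "\<dots> = ?T $$ (i, j)"
      using i j by (subst scalar_prod_right_unit) (auto simp: block_tridiag_def)
    finally show ?thesis using False by simp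
  qed
  have detV: "det V = det (X 1)"
  proof -
    have X1: "X 1 \<in> carrier_mat n n" using X by auto
    have "V = four_block_mat (X 1) (0\<^sub>m n (n * m)) (mat (n * m) n (\<lambda>(i, j). V $$ (i + n, j))) (1\<^sub>m (n * m))"
      using X1 by (intro eq_matI) (auto simp: V_def Nm state_coords_def)
    then have "det V = det (X 1) * det (1\<^sub>m (n * m) :: real mat)"
      using det_four_block_mat_upper_right_zero[OF X1 refl, of "mat (n * m) n (\<lambda>(i, j). V $$ (i + n, j))" "n * m" "1\<^sub>m (n * m)"]
      by simp
    then show ?thesis by simp
  qed
  let ?G = "mat (n * m) (n * m) (\<lambda>(i, j). tridiag_block n L D U (i div n + 1) (j div n + 2) $$ (i mod n, j mod n))"
  let ?S = "mat (n * m + n) (n * m + n) (\<lambda>(i, j). (?T * V) $$ (i, if j < n * m then j + n else j - n * m))"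
  let ?z = "mat n (n * m) (\<lambda>(i, j). ?T $$ (i + n * m, j + n))"
  have TVc: "?T * V \<in> carrier_mat (n * m + n) (n * m + n)"
    using mult_carrier_mat[OF block_tridiag_carrier V] by (simp add: Nm add.commute)
  have S: "?S = four_block_mat ?G (0\<^sub>m (n * m) n) ?z ?W"
  proof (rule eq_matI)
    fix i j assume "i < dim_row (four_block_mat ?G (0\<^sub>m (n * m) n) ?z ?W)"
      "j < dim_col (four_block_mat ?G (0\<^sub>m (n * m) n) ?z ?W)"
    then have i: "i < n * m + n" and j: "j < n * m + n" using W by auto
    have iN: "i < n * N" using i Nm by simp
    have jN: "(if j < n * m then j + n else j - n * m) < n * N" using j by (auto simp: Nm)
    have "?S $$ (i, j) = (?T * V) $$ (i, if j < n * m then j + n else j - n * m)"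
      using i j by simp
    also have "\<dots> = (if j < n * m then ?T $$ (i, j + n) else if i < n * m then 0 else ?W $$ (i - n * m, j - n * m))"
      unfolding TV[OF iN jN] using j by auto
    also have "\<dots> = four_block_mat ?G (0\<^sub>m (n * m) n) ?z ?W $$ (i, j)"
      using i j W n UN XN by (auto simp: block_tridiag_def Nm)
    finally show "?S $$ (i, j) = four_block_mat ?G (0\<^sub>m (n * m) n) ?z ?W $$ (i, j)" .
  qed (use W in auto)
  (* V is four-block triangular, and ?S is ?T * V with its first block column moved to the end *)
  have "det ?T * det (X 1) = det (?T * V)"
    using det_mult[OF block_tridiag_carrier V] detV by simp
  also have "\<dots> = (- 1) ^ (n * m * n) * det ?S"
    by (rule det_swap_cols[OF TVc])
  also have "det ?S = det ?G * det ?W"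
    unfolding S by (rule det_four_block_mat_upper_right_zero) (use W in auto)
  also have "det ?G = (\<Prod>k=1..m. det (U k))"
    by (rule det_superdiagonal_part[OF n L D U]) (use Nm in auto)
  also have "det ?W = (- 1) ^ n * (det (U N) * det (X (N + 1)))"
  proof -
    have "?W = (- 1) \<cdot>\<^sub>m (U N * X (N + 1))" using UN XN by (intro eq_matI) auto
    then show ?thesis using det_mult[OF UN XN] XN by simp
  qed
  also have "(- 1 :: real) ^ (n * m * n) = (- 1) ^ (n * m)"
    by (simp add: minus_one_power_iff)
  also have "(- 1) ^ (n * m) * ((\<Prod>k=1..m. det (U k)) * ((- 1) ^ n * (det (U N) * det (X (N + 1)))))
      = (- 1) ^ (n * m + n) * ((\<Prod>k=1..m. det (U k)) * det (U N)) * det (X (N + 1))"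
    by (simp add: power_add)
  also have "n * m + n = n * N" by (simp add: Nm)
  also have "(\<Prod>k=1..m. det (U k)) * det (U N) = (\<Prod>k=1..N. det (U k))" by (simp add: Nm)
  finally show ?thesis .
qed

section \<open>Inverses, symmetric matrices and scalar products\<close>

lemma mat_inv:
  assumes M: "M \<in> carrier_mat n n" and inv: "invertible_mat M"
  shows "mat_inv M \<in> carrier_mat n n" "M * mat_inv M = 1\<^sub>m n" "mat_inv M * M = 1\<^sub>m n"
proof -
  obtain C where C: "M * C = 1\<^sub>m n" "C * M = 1\<^sub>m (dim_row C)"
    using inv M by (auto simp: invertible_mat_def inverts_mat_def)
  have "dim_col (M * C) = n" "dim_col (C * M) = dim_row C" using C by auto
  then have Cc: "C \<in> carrier_mat n n" using M by auto
  then have "M \<in> Units (ring_mat TYPE(real) n ())"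
    using C M by (auto simp: Units_def ring_mat_def)
  then obtain D where "mat_inverse M = Some D"
    using mat_inverse(1)[OF M, where b = "()"] by (cases "mat_inverse M") auto
  then show "mat_inv M \<in> carrier_mat n n" "M * mat_inv M = 1\<^sub>m n" "mat_inv M * M = 1\<^sub>m n"
    using mat_inverse(2)[OF M] by (auto simp: mat_inv_def)
qed

lemma det_mat_inv:
  assumes "M \<in> carrier_mat n n" "invertible_mat M"
  shows "det M * det (mat_inv M) = 1"
  using det_mult[OF assms(1) mat_inv(1)[OF assms]] mat_inv(2)[OF assms] by simp

text \<open>
  Polarization: unit vectors give the diagonal entries, and sums of two unit vectors give the
  off-diagonal ones, up to symmetry.
\<close>

lemma symmetric_mat_eqI_quadratic_form:
  fixes J K :: "real mat"
  assumes J: "J \<in> carrier_mat m m" "transpose_mat J = J"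
    and K: "K \<in> carrier_mat m m" "transpose_mat K = K"
    and eq: "\<And>v. v \<in> carrier_vec m \<Longrightarrow> (J *\<^sub>v v) \<bullet> v = (K *\<^sub>v v) \<bullet> v"
  shows "J = K"
proof (rule eq_matI)
  fix i j assume "i < dim_row K" "j < dim_col K"
  then have i: "i < m" and j: "j < m" using K by auto
  have entry: "(H *\<^sub>v unit_vec m b) \<bullet> unit_vec m a = H $$ (a, b)"
    if "H \<in> carrier_mat m m" "a < m" "b < m" for H :: "real mat" and a b
    using that by (simp add: scalar_prod_right_unit)
  let ?v = "unit_vec m i + unit_vec m j :: real vec"
  have polar: "(H *\<^sub>v ?v) \<bullet> ?v = H $$ (i, i) + H $$ (j, j) + 2 * H $$ (i, j)"
    if H: "H \<in> carrier_mat m m" "transpose_mat H = H" for H :: "real mat"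
  proof -
    have "H $$ (j, i) = H $$ (i, j)"
      using H i j by (metis carrier_matD index_transpose_mat(1))
    moreover have "(H *\<^sub>v ?v) \<bullet> ?v = H $$ (i, i) + H $$ (j, i) + (H $$ (i, j) + H $$ (j, j))"
    proof -
      have c: "unit_vec m i \<in> carrier_vec m" "unit_vec m j \<in> carrier_vec m" by simp_all
      note Hc = mult_mat_vec_carrier[OF H(1) c(1)] mult_mat_vec_carrier[OF H(1) c(2)]
      show ?thesis
        unfolding mult_add_distrib_mat_vec[OF H(1) c] add_scalar_prod_distrib[OF Hc add_carrier_vec[OF c]]
          scalar_prod_add_distrib[OF Hc(1) c] scalar_prod_add_distrib[OF Hc(2) c]
          entry[OF H(1) i i] entry[OF H(1) i j] entry[OF H(1) j i] entry[OF H(1) j j] ..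
    qed
    ultimately show ?thesis by simp
  qed
  have "J $$ (a, a) = K $$ (a, a)" if "a < m" for a
    using eq[of "unit_vec m a"] entry[OF J(1) that that] entry[OF K(1) that that] by simp
  then show "J $$ (i, j) = K $$ (i, j)"
    using eq[of ?v] polar[OF J] polar[OF K] i j by simp
qed (use J K in auto)

lemma state_coords_scalar_prod:
  assumes y: "\<And>k. 1 \<le> k \<Longrightarrow> k \<le> N \<Longrightarrow> y k \<in> carrier_vec n"
    and x: "\<And>k. 1 \<le> k \<Longrightarrow> k \<le> N \<Longrightarrow> x k \<in> carrier_vec n"
  shows "state_coords n N y \<bullet> state_coords n N x = (\<Sum>k=1..N. y k \<bullet> x k)"
proof -
  have "state_coords n N y \<bullet> state_coords n N x =
    (\<Sum>i<n * N. y (i div n + 1) $ (i mod n) * x (i div n + 1) $ (i mod n))"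
    by (simp add: state_coords_def scalar_prod_def lessThan_atLeast0)
  also have "\<dots> = (\<Sum>b<N. \<Sum>q<n. y (b + 1) $ q * x (b + 1) $ q)"
    unfolding sum_by_blocks by (intro sum.cong) auto
  also have "\<dots> = (\<Sum>b<N. y (b + 1) \<bullet> x (b + 1))"
    using x by (intro sum.cong refl) (simp add: scalar_prod_def lessThan_atLeast0 carrier_vecD[OF x])
  also have "\<dots> = (\<Sum>k=1..N. y k \<bullet> x k)"
    by (rule sum.reindex_bij_witness[where i = "\<lambda>k. k - 1" and j = "\<lambda>b. b + 1"]) auto
  finally show ?thesis .
qed

section \<open>The Hessian of the cost\<close>

locale lq_problem =
  fixes n N :: nat and A B Q :: "nat \<Rightarrow> real mat"
  assumes n: "n \<ge> 1" and N: "N \<ge> 1"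
    and A: "\<And>k. k \<le> N \<Longrightarrow> A k \<in> carrier_mat n n"
    and B: "\<And>k. k \<le> N \<Longrightarrow> B k \<in> carrier_mat n n"
    and Q: "\<And>k. k \<le> N \<Longrightarrow> Q k \<in> carrier_mat n n"
    and B_inv: "\<And>k. k \<le> N \<Longrightarrow> invertible_mat (B k)"
    and P_inv: "\<And>k. k \<le> N \<Longrightarrow> invertible_mat (1\<^sub>m n + A k)"
    and Q_sym: "\<And>k. k \<le> N \<Longrightarrow> transpose_mat (Q k) = Q k"
begin

text \<open>
  With the inner dimension instantiated, the simplifier can discharge these side conditions.
\<close>

lemmas square_carriers [simp] =
  mult_carrier_mat[of _ n n _ n] mult_mat_vec_carrier[of _ n n] minus_carrier_mat[of _ n n]

abbreviation "P \<equiv> P_fwd n A"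
abbreviation "G \<equiv> Gamma B"
abbreviation Gi :: "nat \<Rightarrow> real mat" where "Gi k \<equiv> mat_inv (Gamma B k)"
abbreviation Pit :: "nat \<Rightarrow> real mat" where "Pit k \<equiv> transpose_mat (P_bwd n A k)"

lemma P [simp]: "k \<le> N \<Longrightarrow> P k \<in> carrier_mat n n"
  using A by (simp add: P_fwd_def)

lemma G [simp]: "k \<le> N \<Longrightarrow> G k \<in> carrier_mat n n"
  using B by (auto simp: Gamma_def)

lemma P_bwd:
  assumes "k \<le> N"
  shows "P_bwd n A k \<in> carrier_mat n n" "P_bwd n A k * P k = 1\<^sub>m n"
  using mat_inv[OF P[OF assms]] P_inv[OF assms] by (auto simp: P_bwd_def P_fwd_def)

declare P_bwd(1) [simp]

lemma Pit: "k \<le> N \<Longrightarrow> Pit k \<in> carrier_mat n n"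
  by simp

lemma Pt_mult_Pit: "k \<le> N \<Longrightarrow> transpose_mat (P k) * Pit k = 1\<^sub>m n"
  using transpose_mult[OF P_bwd(1) P] P_bwd(2) by fastforce

lemma G_inv: assumes k: "k \<le> N" shows "invertible_mat (G k)"
proof -
  let ?C = "mat_inv (B k)"
  note Bk = B[OF k]
  note C = mat_inv[OF B B_inv, OF k k]
  have t: "transpose_mat (B k) * transpose_mat ?C = 1\<^sub>m n" "transpose_mat ?C * transpose_mat (B k) = 1\<^sub>m n"
    using transpose_mult[OF C(1) Bk, symmetric] transpose_mult[OF Bk C(1), symmetric] C(2,3)
    by simp_all
  have "G k * (transpose_mat ?C * ?C) = B k * (transpose_mat (B k) * transpose_mat ?C) * ?C"
    using Bk C(1) by (simp add: Gamma_def assoc_mult_mat[of _ n n _ n _ n])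
  also have "\<dots> = 1\<^sub>m n" using t C Bk by simp
  finally have 1: "G k * (transpose_mat ?C * ?C) = 1\<^sub>m n" .
  have "(transpose_mat ?C * ?C) * G k = transpose_mat ?C * (?C * B k) * transpose_mat (B k)"
    using Bk C(1) by (simp add: Gamma_def assoc_mult_mat[of _ n n _ n _ n])
  also have "\<dots> = 1\<^sub>m n" using t C Bk by simp
  finally have 2: "(transpose_mat ?C * ?C) * G k = 1\<^sub>m n" .
  show ?thesis
    using 1 2 G[OF k] C(1) by (auto simp: invertible_mat_def inverts_mat_def)
qed

lemma Gi [simp]: assumes "k \<le> N" shows "Gi k \<in> carrier_mat n n"
  using mat_inv[OF G G_inv, OF assms assms] by simp

lemma Gi_mult: assumes "k \<le> N" shows "G k * Gi k = 1\<^sub>m n" "Gi k * G k = 1\<^sub>m n"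
  using mat_inv[OF G G_inv, OF assms assms] by simp_all

lemma Gi_sym: assumes k: "k \<le> N" shows "transpose_mat (Gi k) = Gi k"
proof -
  have Gt: "transpose_mat (G k) = G k"
    using B[OF k] by (simp add: Gamma_def transpose_mult[of _ n n _ n])
  have "transpose_mat (Gi k) * G k = 1\<^sub>m n"
    using transpose_mult[OF G Gi, OF k k] Gi_mult[OF k] Gt by simp
  then have "transpose_mat (Gi k) = transpose_mat (Gi k) * (G k * Gi k)"
    using Gi_mult[OF k] Gi[OF k] by simp
  also have "\<dots> = (transpose_mat (Gi k) * G k) * Gi k"
    using Gi[OF k] G[OF k] by simp
  also have "\<dots> = Gi k"
    using \<open>transpose_mat (Gi k) * G k = 1\<^sub>m n\<close> Gi[OF k] by simp
  finally show ?thesis .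
qed

text \<open>
  Since \<open>\<Gamma> = B B\<^sup>t\<close>, one has \<open>B\<^sup>t \<Gamma>\<^sup>-\<^sup>1 B = I\<close>; so \<open>\<Gamma>\<^sup>-\<^sup>1\<close> measures the energy of the control that
  produces a given displacement.
\<close>

lemma control_energy:
  assumes k: "k \<le> N" and v: "v \<in> carrier_vec n"
  shows "(Gi k *\<^sub>v (B k *\<^sub>v v)) \<bullet> (B k *\<^sub>v v) = v \<bullet> v"
proof -
  let ?C = "mat_inv (B k)"
  note Bk = B[OF k] and Gk = Gi[OF k]
  note C = mat_inv[OF B B_inv, OF k k]
  have "?C = ?C * (G k * Gi k)" using Gi_mult(1)[OF k] C(1) by simp
  also have "\<dots> = (?C * B k) * (transpose_mat (B k) * Gi k)"
    using Bk C(1) Gk by (simp add: Gamma_def assoc_mult_mat[of _ n n _ n _ n])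
  also have "\<dots> = transpose_mat (B k) * Gi k" using C(3) Bk Gk by simp
  finally have "transpose_mat (B k) * Gi k = ?C" ..
  then have *: "transpose_mat (B k) *\<^sub>v (Gi k *\<^sub>v (B k *\<^sub>v v)) = v"
    using assoc_mult_mat_vec[OF _ Gk, of "transpose_mat (B k)" n "B k *\<^sub>v v"]
      assoc_mult_mat_vec[OF C(1) Bk v] C(3) Bk v by simp
  have "(Gi k *\<^sub>v (B k *\<^sub>v v)) \<bullet> (B k *\<^sub>v v) = (transpose_mat (B k) *\<^sub>v (Gi k *\<^sub>v (B k *\<^sub>v v))) \<bullet> v"
    using Bk Gk v by (intro transpose_vec_mult_scalar[symmetric]) auto
  then show ?thesis unfolding * .
qed

text \<open>
  The Hessian is twice the matrix of the cost, in the coordinates \<open>x\<^sub>1, \<dots>, x\<^sub>N\<close>: eliminating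
  \<open>u\<^sub>k = B\<^sub>k\<^sup>-\<^sup>1 (x\<^sub>k\<^sub>+\<^sub>1 - P\<^sub>k x\<^sub>k)\<close> couples only neighbouring states.
\<close>

definition "S k = Gi (k - 1) + transpose_mat (P k) * Gi k * P k - Q k"
definition "R k = - (transpose_mat (P k) * Gi k)"
definition "L k = - (Gi (k - 1) * P (k - 1))"
definition "hess = block_tridiag n N L S R"

lemma blocks [simp]:
  assumes "k \<le> N"
  shows "S k \<in> carrier_mat n n" "R k \<in> carrier_mat n n" "L k \<in> carrier_mat n n"
  using assms Q[OF assms] P[OF assms] P[of "k - 1"] Gi[OF assms] Gi[of "k - 1"]
  by (auto simp: S_def R_def L_def)

lemma hess_carrier [simp]: "hess \<in> carrier_mat (n * N) (n * N)"
  by (simp add: hess_def)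

lemma R_transpose: "k \<le> N \<Longrightarrow> transpose_mat (R k) = L (Suc k)"
  using Gi_sym[of k] transpose_mult[of "transpose_mat (P k)" n n "Gi k" n]
  by (simp add: R_def L_def transpose_uminus)

lemma S_transpose: assumes k: "k \<le> N" shows "transpose_mat (S k) = S k"
proof -
  have P: "transpose_mat (P k) \<in> carrier_mat n n" using P[OF k] by simp
  have k': "k - 1 \<le> N" using k by simp
  have PGP: "transpose_mat (transpose_mat (P k) * Gi k * P k) = transpose_mat (P k) * Gi k * P k"
    using transpose_mult[OF mult_carrier_mat[OF P Gi[OF k]] lq_problem.P[OF lq_problem_axioms k]]
      transpose_mult[OF P Gi[OF k]] Gi_sym[OF k]
      assoc_mult_mat[OF P Gi[OF k] lq_problem.P[OF lq_problem_axioms k]]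
    by (simp only: transpose_transpose)
  then show ?thesis
    using k PGP[unfolded One_nat_def] Gi_sym[OF k'] Q_sym[OF k] Gi[OF k] Gi[OF k'] Q[OF k] lq_problem.P[OF lq_problem_axioms k]
    by (simp add: S_def transpose_add[of _ n n] transpose_minus[of _ n n] del: assoc_mult_mat)
qed

lemma hess_sym: "transpose_mat hess = hess"
proof (rule eq_matI)
  fix i j assume "i < dim_row hess" "j < dim_col hess"
  then have i: "i < n * N" and j: "j < n * N" using hess_carrier by auto
  define a b p q where "a = i div n + 1" "b = j div n + 1" "p = i mod n" "q = j mod n"
  have a: "a \<le> N" "b \<le> N" "p < n" "q < n"
    using div_block_less[OF i] div_block_less[OF j] n by (auto simp: a_b_p_q_def)
  have "L (Suc k) $$ (r, s) = R k $$ (s, r)" if "k \<le> N" "r < n" "s < n" for k r s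
    using that carrier_matD[OF blocks(2)[OF that(1)]] by (simp add: R_transpose[symmetric])
  moreover have "S k $$ (r, s) = S k $$ (s, r)" if "k \<le> N" "r < n" "s < n" for k r s
    using that carrier_matD[OF blocks(1)[OF that(1)]] by (subst S_transpose[OF that(1), symmetric]) simp
  ultimately have "tridiag_block n L S R b a $$ (q, p) = tridiag_block n L S R a b $$ (p, q)"
    using a by (auto simp: tridiag_block_def)
  then show "transpose_mat hess $$ (i, j) = hess $$ (i, j)"
    using i j by (simp add: hess_def block_tridiag_def a_b_p_q_def)
qed (simp_all add: carrier_matD[OF hess_carrier])

text \<open>
  The discrete Euler-Lagrange operator, with the covectors
  \<open>w\<^sub>k = \<Gamma>\<^sub>k\<^sup>-\<^sup>1 (x\<^sub>k\<^sub>+\<^sub>1 - P\<^sub>k x\<^sub>k)\<close> in the role of momenta. This form is the one that summation by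
  parts produces.
\<close>

lemma hess_mult_coords:
  assumes x: "\<And>k. k \<le> N + 1 \<Longrightarrow> x k \<in> carrier_vec n"
    and x0: "x 0 = 0\<^sub>v n" and xN: "x (N + 1) = 0\<^sub>v n"
    and w: "\<And>k. k \<le> N \<Longrightarrow> w k = Gi k *\<^sub>v (x (k + 1) - P k *\<^sub>v x k)"
  shows "hess *\<^sub>v state_coords n N x =
    state_coords n N (\<lambda>k. w (k - 1) - transpose_mat (P k) *\<^sub>v w k - Q k *\<^sub>v x k)"
proof -
  have step: "L k *\<^sub>v x (k - 1) + S k *\<^sub>v x k + R k *\<^sub>v x (k + 1) =
      w (k - 1) - transpose_mat (P k) *\<^sub>v w k - Q k *\<^sub>v x k" if k: "1 \<le> k" "k \<le> N" for k
  proof -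
    have k': "k - 1 \<le> N" "k - 1 + 1 = k" using k by auto
    have xk: "x (k - 1) \<in> carrier_vec n" "x k \<in> carrier_vec n" "x (k + 1) \<in> carrier_vec n"
      using x k by auto
    note c = xk P[OF k(2)] Gi[OF k(2)] Q[OF k(2)] P[OF k'(1)] Gi[OF k'(1)]
    let ?a = "Gi (k - 1) *\<^sub>v (P (k - 1) *\<^sub>v x (k - 1))"
    let ?b = "Gi (k - 1) *\<^sub>v x k"
    let ?c = "transpose_mat (P k) *\<^sub>v (Gi k *\<^sub>v (P k *\<^sub>v x k))"
    let ?d = "Q k *\<^sub>v x k"
    let ?e = "transpose_mat (P k) *\<^sub>v (Gi k *\<^sub>v x (k + 1))"
    have "L k *\<^sub>v x (k - 1) = - ?a"
      using c by (simp add: L_def assoc_mult_mat_vec[of _ n n _ n])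
    moreover have "S k *\<^sub>v x k = ?b + ?c - ?d"
      using c by (simp add: S_def minus_mult_distrib_mat_vec[of _ n n] add_mult_distrib_mat_vec[of _ n n]
          assoc_mult_mat_vec[of _ n n _ n])
    moreover have "R k *\<^sub>v x (k + 1) = - ?e"
      using c by (simp add: R_def assoc_mult_mat_vec[of _ n n _ n])
    moreover have "w (k - 1) = ?b - ?a"
      using c k' by (simp add: w mult_minus_distrib_mat_vec[of _ n n])
    moreover have "transpose_mat (P k) *\<^sub>v w k = ?e - ?c"
      using c k by (simp add: w mult_minus_distrib_mat_vec[of _ n n])
    moreover have "- ?a + (?b + ?c - ?d) + - ?e = ?b - ?a - (?e - ?c) - ?d"
      using c by (intro eq_vecI) (simp_all del: index_mult_mat_vec)
    ultimately show ?thesis by simp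
  qed
  have "hess *\<^sub>v state_coords n N x =
    state_coords n N (\<lambda>k. L k *\<^sub>v x (k - 1) + S k *\<^sub>v x k + R k *\<^sub>v x (k + 1))"
    unfolding hess_def by (rule block_tridiag_mult_coords) (use x x0 xN in auto)
  also have "\<dots> = state_coords n N (\<lambda>k. w (k - 1) - transpose_mat (P k) *\<^sub>v w k - Q k *\<^sub>v x k)"
  proof (rule eq_vecI)
    fix i assume "i < dim_vec (state_coords n N (\<lambda>k. w (k - 1) - transpose_mat (P k) *\<^sub>v w k - Q k *\<^sub>v x k))"
    then have i: "i < n * N" by (simp add: state_coords_def)
    then have "1 \<le> i div n + 1" "i div n + 1 \<le> N" using div_block_less[OF i] by auto
    from step[OF this] i
    show "state_coords n N (\<lambda>k. L k *\<^sub>v x (k - 1) + S k *\<^sub>v x k + R k *\<^sub>v x (k + 1)) $ i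
      = state_coords n N (\<lambda>k. w (k - 1) - transpose_mat (P k) *\<^sub>v w k - Q k *\<^sub>v x k) $ i"
      by (simp add: state_coords_def)
  qed (simp add: state_coords_def)
  finally show ?thesis .
qed

text \<open>
  The energy \<open>u\<^sub>k \<bullet> u\<^sub>k\<close> equals \<open>w\<^sub>k \<bullet> (x\<^sub>k\<^sub>+\<^sub>1 - P\<^sub>k x\<^sub>k)\<close>. Summation by parts collects, at each \<open>x\<^sub>k\<close>,
  the covector \<open>w\<^sub>k\<^sub>-\<^sub>1 - P\<^sub>k\<^sup>t w\<^sub>k\<close>, without boundary terms because both end states vanish.
\<close>

lemma cost_eq_hess:
  assumes xu: "(x, u) \<in> constraint_space n N A B"
  shows "cost N Q x u = 1 / 2 * ((hess *\<^sub>v state_coords n N x) \<bullet> state_coords n N x)"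
proof -
  have x: "\<And>k. k \<le> N + 1 \<Longrightarrow> x k \<in> carrier_vec n" and u: "\<And>k. k \<le> N \<Longrightarrow> u k \<in> carrier_vec n"
    and dyn: "\<And>k. k \<le> N \<Longrightarrow> x (k + 1) - x k = A k *\<^sub>v x k + B k *\<^sub>v u k"
    and x0: "x 0 = 0\<^sub>v n" and xN: "x (N + 1) = 0\<^sub>v n"
    using xu by (auto simp: constraint_space_def)
  define w where "w k = Gi k *\<^sub>v (x (k + 1) - P k *\<^sub>v x k)" for k
  have w: "w k \<in> carrier_vec n" if "k \<le> N" for k
    using that x by (simp add: w_def)
  have energy: "u k \<bullet> u k = w k \<bullet> x (k + 1) - (transpose_mat (P k) *\<^sub>v w k) \<bullet> x k" if k: "k \<le> N" for k
  proof -
    have xk: "x k \<in> carrier_vec n" "x (k + 1) \<in> carrier_vec n" using x k by auto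
    note c = xk A[OF k] B[OF k] u[OF k] P[OF k] w[OF k]
    have Pk: "P k *\<^sub>v x k = x k + A k *\<^sub>v x k"
      using c by (simp add: P_fwd_def add_mult_distrib_mat_vec[of _ n n])
    have "x (k + 1) - P k *\<^sub>v x k = (x (k + 1) - x k) - A k *\<^sub>v x k"
      unfolding Pk using c by (intro eq_vecI) (simp_all del: index_mult_mat_vec)
    also have "\<dots> = B k *\<^sub>v u k"
      unfolding dyn[OF k] using c by (intro eq_vecI) (simp_all del: index_mult_mat_vec)
    finally have d: "x (k + 1) - P k *\<^sub>v x k = B k *\<^sub>v u k" .
    have "u k \<bullet> u k = w k \<bullet> (x (k + 1) - P k *\<^sub>v x k)"
      using control_energy[OF k u[OF k]] unfolding w_def d ..
    also have "\<dots> = w k \<bullet> x (k + 1) - w k \<bullet> (P k *\<^sub>v x k)"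
      using c by (simp add: scalar_prod_minus_distrib[of _ n])
    also have "w k \<bullet> (P k *\<^sub>v x k) = (transpose_mat (P k) *\<^sub>v w k) \<bullet> x k"
      using transpose_vec_mult_scalar[OF P[OF k] xk(1) w[OF k]] ..
    finally show ?thesis .
  qed
  let ?y = "\<lambda>k. w (k - 1) - transpose_mat (P k) *\<^sub>v w k - Q k *\<^sub>v x k"
  have yx: "?y k \<bullet> x k = w (k - 1) \<bullet> x k - (transpose_mat (P k) *\<^sub>v w k) \<bullet> x k - (Q k *\<^sub>v x k) \<bullet> x k"
    if k: "1 \<le> k" "k \<le> N" for k
  proof -
    have xk: "x k \<in> carrier_vec n" using x k by auto
    have k': "k - 1 \<le> N" using k by simp
    show ?thesis using xk P[OF k(2)] Q[OF k(2)] w[OF k(2)] w[OF k']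
      by (simp add: minus_scalar_prod_distrib[of _ n])
  qed
  have "(\<Sum>k=0..N. u k \<bullet> u k - (Q k *\<^sub>v x k) \<bullet> x k) =
      (\<Sum>k=0..N. w k \<bullet> x (k + 1)) - (\<Sum>k=0..N. (transpose_mat (P k) *\<^sub>v w k) \<bullet> x k)
      - (\<Sum>k=0..N. (Q k *\<^sub>v x k) \<bullet> x k)"
    by (simp add: energy sum_subtractf)
  also have "(\<Sum>k=0..N. w k \<bullet> x (k + 1)) = (\<Sum>k=1..N. w (k - 1) \<bullet> x k)"
  proof -
    have "(\<Sum>k=0..N. w k \<bullet> x (k + 1)) = (\<Sum>k<N. w k \<bullet> x (k + 1))"
      using w[of N] by (simp add: xN[simplified] lessThan_Suc_atMost[symmetric] atMost_atLeast0[symmetric])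
    also have "\<dots> = (\<Sum>k=1..N. w (k - 1) \<bullet> x k)"
      by (rule sum.reindex_bij_witness[where i = "\<lambda>k. k - 1" and j = "\<lambda>b. b + 1"]) auto
    finally show ?thesis .
  qed
  also have "(\<Sum>k=0..N. (transpose_mat (P k) *\<^sub>v w k) \<bullet> x k) =
      (\<Sum>k=1..N. (transpose_mat (P k) *\<^sub>v w k) \<bullet> x k)"
    using P[of 0] w[of 0] by (simp add: sum.atLeast_Suc_atMost x0)
  also have "(\<Sum>k=0..N. (Q k *\<^sub>v x k) \<bullet> x k) = (\<Sum>k=1..N. (Q k *\<^sub>v x k) \<bullet> x k)"
    using Q[of 0] by (simp add: sum.atLeast_Suc_atMost x0)
  also have "(\<Sum>k=1..N. w (k - 1) \<bullet> x k) - (\<Sum>k=1..N. (transpose_mat (P k) *\<^sub>v w k) \<bullet> x k)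
      - (\<Sum>k=1..N. (Q k *\<^sub>v x k) \<bullet> x k) = (\<Sum>k=1..N. ?y k \<bullet> x k)"
    unfolding sum_subtractf[symmetric] by (intro sum.cong refl) (simp only: yx atLeastAtMost_iff)
  also have "\<dots> = state_coords n N ?y \<bullet> state_coords n N x"
    using x Q P w by (intro state_coords_scalar_prod[symmetric]) (simp_all add: square_carriers)
  also have "state_coords n N ?y = hess *\<^sub>v state_coords n N x"
    by (rule hess_mult_coords[symmetric]) (use x x0 xN w_def in auto)
  finally show ?thesis by (simp add: cost_def)
qed

text \<open>
  Every choice of intermediate states is reached, because the \<open>B\<^sub>k\<close> are invertible. Hence the cost
  determines the quadratic form on the whole coordinate space, and its matrix is unique.
\<close>

lemma state_coords_surj:
  assumes v: "v \<in> carrier_vec (n * N)"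
  obtains x u where "(x, u) \<in> constraint_space n N A B" "state_coords n N x = v"
proof
  define x where "x k = (if 1 \<le> k \<and> k \<le> N then vec n (\<lambda>i. v $ ((k - 1) * n + i)) else 0\<^sub>v n)" for k
  define u where "u k = mat_inv (B k) *\<^sub>v (x (k + 1) - x k - A k *\<^sub>v x k)" for k
  have x: "x k \<in> carrier_vec n" for k by (auto simp: x_def)
  have u: "u k \<in> carrier_vec n" if "k \<le> N" for k
    using mat_inv(1)[OF B B_inv, OF that that] x A[OF that] by (simp add: u_def)
  have "x (k + 1) - x k = A k *\<^sub>v x k + B k *\<^sub>v u k" if k: "k \<le> N" for k
  proof -
    note C = mat_inv[OF B B_inv, OF k k]
    have d: "x (k + 1) - x k - A k *\<^sub>v x k \<in> carrier_vec n" using x A[OF k] by auto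
    have "B k *\<^sub>v u k = x (k + 1) - x k - A k *\<^sub>v x k"
      using assoc_mult_mat_vec[OF B[OF k] C(1) d] C(2) d by (simp add: u_def)
    then show ?thesis using x[of k] x[of "k + 1"] A[OF k]
      by (intro eq_vecI) (simp_all del: index_mult_mat_vec)
  qed
  then show "(x, u) \<in> constraint_space n N A B"
    using x u by (auto simp: constraint_space_def) (simp_all add: x_def)
  show "state_coords n N x = v"
    using v n by (intro eq_vecI) (auto simp: state_coords_def x_def Suc_leI dest: div_block_less)
qed

lemma cost_matrix_eq_hess: "cost_matrix n N A B Q = (1 / 2) \<cdot>\<^sub>m hess"
  unfolding cost_matrix_def
proof (rule the_equality)
  have "((1 / 2) \<cdot>\<^sub>m hess *\<^sub>v v) \<bullet> v = 1 / 2 * ((hess *\<^sub>v v) \<bullet> v)" if "v \<in> carrier_vec (n * N)" for v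
  proof -
    have "(1 / 2) \<cdot>\<^sub>m hess *\<^sub>v v = (1 / 2) \<cdot>\<^sub>v (hess *\<^sub>v v)"
      using that by (intro eq_vecI) (simp_all add: carrier_matD[OF hess_carrier])
    then show ?thesis using that by (simp add: carrier_matD[OF hess_carrier])
  qed
  moreover have coords: "state_coords n N x \<in> carrier_vec (n * N)" for x
    by (simp add: state_coords_def)
  ultimately have half: "((1 / 2) \<cdot>\<^sub>m hess *\<^sub>v state_coords n N x) \<bullet> state_coords n N x = cost N Q x u"
    if "(x, u) \<in> constraint_space n N A B" for x u
    using cost_eq_hess[OF that] by metis
  have sym: "transpose_mat ((1 / 2) \<cdot>\<^sub>m hess) = (1 / 2) \<cdot>\<^sub>m hess"
    by (subst (2) hess_sym[symmetric]) auto
  show "represents_cost n N A B Q ((1 / 2) \<cdot>\<^sub>m hess)"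
    using half sym by (auto simp: represents_cost_def)
  fix J assume J: "represents_cost n N A B Q J"
  show "J = (1 / 2) \<cdot>\<^sub>m hess"
  proof (rule symmetric_mat_eqI_quadratic_form)
    fix v :: "real vec" assume "v \<in> carrier_vec (n * N)"
    then obtain x u where "(x, u) \<in> constraint_space n N A B" "state_coords n N x = v"
      by (rule state_coords_surj)
    then show "(J *\<^sub>v v) \<bullet> v = ((1 / 2) \<cdot>\<^sub>m hess *\<^sub>v v) \<bullet> v"
      using J half by (auto simp: represents_cost_def)
  qed (use J sym in \<open>auto simp: represents_cost_def\<close>)
qed

end

section \<open>The Hamiltonian flow and the determinant\<close>

lemma det_ordered_prod:
  "(\<And>k. k < m \<Longrightarrow> F k \<in> carrier_mat n n) \<Longrightarrow>
    ordered_prod n F m \<in> carrier_mat n n \<and> det (ordered_prod n F m) = (\<Prod>k<m. det (F k))"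
proof (induction m)
  case (Suc m)
  then have IH: "ordered_prod n F m \<in> carrier_mat n n" "det (ordered_prod n F m) = (\<Prod>k<m. det (F k))"
    and F: "F m \<in> carrier_mat n n" by auto
  show ?case using det_mult[OF F IH(1)] mult_carrier_mat[OF F IH(1)] IH(2) by simp
qed simp

context lq_problem
begin

text \<open>
  The first block column of \<open>M\<^sub>k\<^sub>-\<^sub>1 \<cdots> M\<^sub>0\<close>. Its blocks are the costate \<open>Y\<close> and the state \<open>X\<close> of the
  matrix solution of the Hamiltonian system that starts at costate \<open>I\<close> and state \<open>0\<close>.
\<close>

primrec flow :: "nat \<Rightarrow> real mat \<times> real mat" where
  "flow 0 = (1\<^sub>m n, 0\<^sub>m n n)"
| "flow (Suc k) = (let Y = Pit k * (fst (flow k) - Q k * snd (flow k))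
     in (Y, G k * Y + P k * snd (flow k)))"

definition "Y k = fst (flow k)"
definition "X k = snd (flow k)"

lemma flow_simps:
  "Y 0 = 1\<^sub>m n" "X 0 = 0\<^sub>m n n"
  "Y (Suc k) = Pit k * (Y k - Q k * X k)"
  "X (Suc k) = G k * Y (Suc k) + P k * X k"
  by (simp_all add: X_def Y_def Let_def)

lemma flow_carrier: "k \<le> N + 1 \<Longrightarrow> Y k \<in> carrier_mat n n \<and> X k \<in> carrier_mat n n"
proof (induction k)
  case (Suc k)
  then have "Y (Suc k) \<in> carrier_mat n n" using Q[of k] by (simp add: flow_simps)
  then show ?case using Suc by (simp add: flow_simps(4))
qed (simp add: flow_simps)

text \<open>
  Multiplication by \<open>M\<^sub>k\<close> from the left acts on each block column separately, so the second one can
  be left unspecified.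
\<close>

lemma ordered_prod_M_step:
  "k \<le> N + 1 \<Longrightarrow> \<exists>E F. E \<in> carrier_mat n n \<and> F \<in> carrier_mat n n \<and>
    ordered_prod (2 * n) (M_step n A B Q) k = four_block_mat (Y k) E (X k) F"
proof (induction k)
  case 0
  have "ordered_prod (2 * n) (M_step n A B Q) 0 = four_block_mat (Y 0) (0\<^sub>m n n) (X 0) (1\<^sub>m n)"
    by (simp add: flow_simps mult_2)
  then show ?case by (intro exI[of _ "0\<^sub>m n n"] exI[of _ "1\<^sub>m n"]) simp
next
  case (Suc k)
  then have k: "k \<le> N" by simp
  from Suc obtain E F where EF: "E \<in> carrier_mat n n" "F \<in> carrier_mat n n"
    and IH: "ordered_prod (2 * n) (M_step n A B Q) k = four_block_mat (Y k) E (X k) F" by auto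
  have YX: "Y k \<in> carrier_mat n n" "X k \<in> carrier_mat n n" using flow_carrier[of k] k by auto
  note c = Pit[OF k] P[OF k] G[OF k] Q[OF k]
  let ?K = "P k - G k * Pit k * Q k"
  have GP: "G k * Pit k \<in> carrier_mat n n" and PQ: "Pit k * Q k \<in> carrier_mat n n"
    and GPQ: "G k * Pit k * Q k \<in> carrier_mat n n" and K: "?K \<in> carrier_mat n n"
    using c by (simp_all del: assoc_mult_mat)
  have "M_step n A B Q k = four_block_mat (Pit k) (- (Pit k * Q k)) (G k * Pit k) ?K"
  proof -
    have "G k * Pit k * - Q k + P k = ?K"
      using c GPQ by (intro eq_matI) (simp_all del: assoc_mult_mat index_mult_mat(1))
    then show ?thesis
      unfolding M_step_def using c GP
      by (subst mult_four_block_mat[of _ n n _ n _ n _ _ n _ n]) (simp_all del: assoc_mult_mat)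
  qed
  then have "ordered_prod (2 * n) (M_step n A B Q) (Suc k) =
    four_block_mat (Pit k * Y k + - (Pit k * Q k) * X k) (Pit k * E + - (Pit k * Q k) * F)
      (G k * Pit k * Y k + ?K * X k) (G k * Pit k * E + ?K * F)"
    using IH mult_four_block_mat[OF Pit[OF k] _ GP K YX(1) EF(1) YX(2) EF(2), of "- (Pit k * Q k)"] PQ
    by simp
  moreover have "Pit k * Y k + - (Pit k * Q k) * X k = Y (Suc k)"
  proof -
    have "Y (Suc k) = Pit k * Y k - Pit k * (Q k * X k)"
      using c YX by (simp add: flow_simps mult_minus_distrib_mat[of _ n n _ n])
    moreover have "- (Pit k * Q k) * X k = - (Pit k * (Q k * X k))"
      using c YX by (simp add: assoc_mult_mat[of _ n n _ n _ n])
    ultimately show ?thesis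
      using c YX by (simp add: add_uminus_minus_mat[of _ n n])
  qed
  moreover have "G k * Pit k * Y k + ?K * X k = X (Suc k)"
  proof -
    have "G k * Y (Suc k) = G k * (Pit k * Y k) - G k * (Pit k * (Q k * X k))"
      using c YX by (simp add: flow_simps mult_minus_distrib_mat[of _ n n _ n])
    moreover have "?K * X k = P k * X k - G k * (Pit k * (Q k * X k))"
      using c YX GPQ by (simp add: minus_mult_distrib_mat[of _ n n _ _ n] assoc_mult_mat[of _ n n _ n _ n])
    moreover have "G k * Pit k * Y k = G k * (Pit k * Y k)"
      using c YX by (simp add: assoc_mult_mat[of _ n n _ n _ n])
    moreover have "a + (b - d) = a - d + b" if "a \<in> carrier_mat n n" "b \<in> carrier_mat n n" "d \<in> carrier_mat n n"
      for a b d :: "real mat"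
      using that by (intro eq_matI) auto
    ultimately show ?thesis
      using c YX by (simp add: flow_simps(4))
  qed
  moreover have "Pit k * E + - (Pit k * Q k) * F \<in> carrier_mat n n" 
    "G k * Pit k * E + ?K * F \<in> carrier_mat n n"
    using PQ K EF by (simp_all del: assoc_mult_mat)
  ultimately show ?case
    by (intro exI[of _ "Pit k * E + - (Pit k * Q k) * F"] exI[of _ "G k * Pit k * E + ?K * F"] conjI)
      (simp_all only:)
qed

lemma Phi3_eq: "Phi3 n N A B Q = X (N + 1)"
proof -
  obtain E F where EF: "E \<in> carrier_mat n n" "F \<in> carrier_mat n n"
    and Phi: "Phi n N A B Q = four_block_mat (Y (N + 1)) E (X (N + 1)) F"
    using ordered_prod_M_step[of "N + 1"] by (auto simp: Phi_def)
  have YX: "Y (N + 1) \<in> carrier_mat n n" "X (N + 1) \<in> carrier_mat n n"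
    using flow_carrier[of "N + 1"] by auto
  show ?thesis
    unfolding Phi3_def Phi using EF YX by (intro eq_matI) (auto simp: split_block_def Let_def)
qed

text \<open>
  Eliminating the costate turns the Hamiltonian system into the second order recurrence of the
  Hessian. The state equation gives \<open>Y\<^sub>k\<^sub>+\<^sub>1 = \<Gamma>\<^sub>k\<^sup>-\<^sup>1 (X\<^sub>k\<^sub>+\<^sub>1 - P\<^sub>k X\<^sub>k)\<close>, and substituting this in the
  costate equation \<open>P\<^sub>k\<^sup>t Y\<^sub>k\<^sub>+\<^sub>1 = Y\<^sub>k - Q\<^sub>k X\<^sub>k\<close> gives \<open>L\<^sub>k X\<^sub>k\<^sub>-\<^sub>1 + S\<^sub>k X\<^sub>k + R\<^sub>k X\<^sub>k\<^sub>+\<^sub>1 = 0\<close>.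
\<close>

lemma flow_recurrence:
  assumes k: "1 \<le> k" "k \<le> N"
  shows "L k * X (k - 1) + S k * X k + R k * X (k + 1) = 0\<^sub>m n n"
proof -
  obtain j where j: "k = Suc j" using k by (cases k) auto
  have jN: "j \<le> N" using j k by simp
  have c: "X j \<in> carrier_mat n n" "X k \<in> carrier_mat n n" "Y k \<in> carrier_mat n n" "Y (Suc k) \<in> carrier_mat n n"
    "P j \<in> carrier_mat n n" "P k \<in> carrier_mat n n" "Gi j \<in> carrier_mat n n" "Gi k \<in> carrier_mat n n"
    "Q k \<in> carrier_mat n n" "G j \<in> carrier_mat n n" "G k \<in> carrier_mat n n" "Pit k \<in> carrier_mat n n"
    using flow_carrier[of j] flow_carrier[of k] flow_carrier[of "Suc k"] jN k Q[OF k(2)] by simp_all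
  let ?a = "Gi j * (P j * X j)"
  let ?c = "transpose_mat (P k) * (Gi k * (P k * X k))"
  let ?q = "Q k * X k"
  have Gi_X: "Gi i * X (Suc i) = Y (Suc i) + Gi i * (P i * X i)" if i: "i \<le> N" for i
  proof -
    have ci: "Y (Suc i) \<in> carrier_mat n n" "X i \<in> carrier_mat n n"
      using flow_carrier[of "Suc i"] flow_carrier[of i] i by auto
    have "Gi i * X (Suc i) = Gi i * (G i * Y (Suc i)) + Gi i * (P i * X i)"
      unfolding flow_simps(4) using ci i by (simp add: mult_add_distrib_mat[of _ n n _ n])
    also have "Gi i * (G i * Y (Suc i)) = Y (Suc i)"
      using assoc_mult_mat[OF Gi[OF i] G[OF i] ci(1)] Gi_mult(2)[OF i] ci by simp
    finally show ?thesis .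
  qed
  have PtY: "transpose_mat (P k) * Y (Suc k) = Y k - ?q"
  proof -
    have "transpose_mat (P k) * Y (Suc k) = transpose_mat (P k) * Pit k * (Y k - ?q)"
      unfolding flow_simps(3) using c assoc_mult_mat[of "transpose_mat (P k)" n n "Pit k" n "Y k - ?q" n] by simp
    then show ?thesis using Pt_mult_Pit[OF k(2)] c by simp
  qed
  have LX: "L k * X (k - 1) = - ?a"
    using c by (simp add: L_def j assoc_mult_mat[of _ n n _ n _ n])
  have SX: "S k * X k = Y k + ?a + ?c - ?q"
  proof -
    have "S k * X k = Gi j * X k + transpose_mat (P k) * Gi k * P k * X k - ?q"
      using c by (simp add: S_def j minus_mult_distrib_mat[of _ n n _ _ n]
          add_mult_distrib_mat[of _ n n _ _ n] del: assoc_mult_mat)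
    also have "transpose_mat (P k) * Gi k * P k * X k = ?c"
      using c by (simp add: assoc_mult_mat[of _ n n _ n _ n])
    also have "Gi j * X k = Y k + ?a" using Gi_X[OF jN] by (simp add: j)
    finally show ?thesis .
  qed
  have RX: "R k * X (k + 1) = - (Y k - ?q + ?c)"
  proof -
    have "X (Suc k) \<in> carrier_mat n n" using flow_carrier[of "Suc k"] k by simp
    then have "R k * X (k + 1) = - (transpose_mat (P k) * (Gi k * X (Suc k)))"
      using c by (simp add: R_def assoc_mult_mat[of _ n n _ n _ n])
    also have "transpose_mat (P k) * (Gi k * X (Suc k)) = transpose_mat (P k) * Y (Suc k) + ?c"
      unfolding Gi_X[OF k(2)] using c by (simp add: mult_add_distrib_mat[of _ n n _ n])
    finally show ?thesis unfolding PtY .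
  qed
  have cancel: "- a + (y + a + d - q) + - (y - q + d) = 0\<^sub>m n n"
    if "a \<in> carrier_mat n n" "y \<in> carrier_mat n n" "d \<in> carrier_mat n n" "q \<in> carrier_mat n n"
    for a y d q :: "real mat"
    using that by (intro eq_matI) auto
  show ?thesis unfolding LX SX RX by (rule cancel) (use c in simp_all)
qed

lemma det_X_1: "det (X 1) * det (P 0) = det (G 0)"
proof -
  have "1\<^sub>m n - Q 0 * 0\<^sub>m n n = 1\<^sub>m n" using Q[of 0] by (intro eq_matI) auto
  then have "Y 1 = Pit 0" using flow_simps(3)[of 0] right_mult_one_mat[OF Pit[of 0]] by (simp add: flow_simps(1,2))
  then have "X 1 = G 0 * Pit 0"
    using flow_simps(4)[of 0] right_mult_zero_mat[OF P[of 0]]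
      right_add_zero_mat[OF mult_carrier_mat[OF G[of 0] Pit[of 0]]]
    by (simp add: flow_simps(2))
  moreover have "det (P 0) * det (Pit 0) = 1"
    using Pt_mult_Pit[of 0] det_mult[of "transpose_mat (P 0)" n "Pit 0"] det_transpose[of "P 0" n] by simp
  ultimately show ?thesis by (simp add: det_mult[of _ n] mult.assoc mult.commute[of "det (Pit 0)"])
qed

text \<open>
  The signs \<open>(-1)\<^sup>n\<close> of the \<open>N\<close> blocks \<open>R\<^sub>k = - P\<^sub>k\<^sup>t \<Gamma>\<^sub>k\<^sup>-\<^sup>1\<close> cancel the sign in \<open>det_block_tridiag\<close>, and
  dividing by \<open>det X\<^sub>1 = det \<Gamma>\<^sub>0 / det P\<^sub>0\<close> supplies the factors with index \<open>0\<close>.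
\<close>

lemma det_hess: "det hess = det (X (N + 1)) * (\<Prod>k=0..N. det (P k)) * (\<Prod>k=0..N. det (Gi k))"
proof -
  have detG: "det (G k) * det (Gi k) = 1" if "k \<le> N" for k
    using det_mat_inv[OF G G_inv, OF that that] .
  have detR: "det (R k) = (- 1) ^ n * (det (P k) * det (Gi k))" if k: "k \<le> N" for k
  proof -
    have "R k = (- 1) \<cdot>\<^sub>m (transpose_mat (P k) * Gi k)"
      using Gi[OF k] P[OF k] by (intro eq_matI) (auto simp: R_def)
    then show ?thesis
      using k det_transpose[OF P[OF k]] det_mult[of "transpose_mat (P k)" n "Gi k"] carrier_matD[OF Gi[OF k]]
      by simp
  qed
  have "det hess * det (X 1) = (- 1) ^ (n * N) * (\<Prod>k=1..N. det (R k)) * det (X (N + 1))"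
    unfolding hess_def
    by (rule det_block_tridiag) (use n N flow_carrier flow_recurrence in \<open>auto simp: flow_simps(2)\<close>)
  also have "(\<Prod>k=1..N. det (R k)) = ((- 1) ^ n) ^ N * ((\<Prod>k=1..N. det (P k)) * (\<Prod>k=1..N. det (Gi k)))"
    by (simp add: detR prod.distrib)
  also have "(- 1) ^ (n * N) * (((- 1) ^ n) ^ N * ((\<Prod>k=1..N. det (P k)) * (\<Prod>k=1..N. det (Gi k)))) =
    (\<Prod>k=1..N. det (P k)) * (\<Prod>k=1..N. det (Gi k))"
    by (simp add: power_mult[symmetric] mult.assoc[symmetric] power_add[symmetric])
  finally have eq: "det hess * det (X 1) =
    (\<Prod>k=1..N. det (P k)) * (\<Prod>k=1..N. det (Gi k)) * det (X (N + 1))" .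
  have "det hess = det hess * (det (X 1) * det (P 0)) * det (Gi 0)"
    unfolding det_X_1 using detG[of 0] by (simp add: mult.assoc)
  also have "\<dots> = (det hess * det (X 1)) * (det (P 0) * det (Gi 0))" by (simp only: mult_ac)
  also have "\<dots> = det (X (N + 1)) * (det (P 0) * (\<Prod>k=1..N. det (P k))) * (det (Gi 0) * (\<Prod>k=1..N. det (Gi k)))"
    unfolding eq by (simp only: mult_ac)
  also have "\<dots> = det (X (N + 1)) * (\<Prod>k=0..N. det (P k)) * (\<Prod>k=0..N. det (Gi k))"
    by (simp add: prod.atLeast_Suc_atMost)
  finally show ?thesis .
qed

lemma det_cost_matrix:
  "det (cost_matrix n N A B Q) =
    (1 / 2 ^ (n * N)) * det (Phi3 n N A B Q) * det (P_total n N A) * (\<Prod>k=0..N. det (Gi k))"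
proof -
  have "det (P_total n N A) = (\<Prod>k=0..N. det (P k))"
    using det_ordered_prod[of "N + 1" P n]
    by (simp add: P_total_def lessThan_Suc_atMost atMost_atLeast0 del: ordered_prod.simps)
  then show ?thesis
    by (simp add: cost_matrix_eq_hess det_hess Phi3_eq carrier_matD[OF hess_carrier] power_one_over)
qed

end

theorem theorem2:
  fixes n N :: nat and A B Q :: "nat \<Rightarrow> real mat"
  assumes "n \<ge> 1" and "N \<ge> 1"
    and "\<And>k. k \<le> N \<Longrightarrow> A k \<in> carrier_mat n n"
    and "\<And>k. k \<le> N \<Longrightarrow> B k \<in> carrier_mat n n"
    and "\<And>k. k \<le> N \<Longrightarrow> Q k \<in> carrier_mat n n"
    and "\<And>k. k \<le> N \<Longrightarrow> invertible_mat (B k)"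
    and "\<And>k. k \<le> N \<Longrightarrow> invertible_mat (1\<^sub>m n + A k)"
    and "\<And>k. k \<le> N \<Longrightarrow> transpose_mat (Q k) = Q k"
  shows "det (cost_matrix n N A B Q) =
    (1 / 2 ^ (n * N)) * det (Phi3 n N A B Q) * det (P_total n N A)
      * (\<Prod>k=0..N. det (mat_inv (Gamma B k)))"
proof -
  interpret lq_problem n N A B Q by unfold_locales (fact assms)+
  show ?thesis by (rule det_cost_matrix)
qed

end
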